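(* Let $\mathfrak{F}$ be a selective ultrafilter on $\omega$ and let $\mathbb{Q}_*=\mathbb{Q}^\omega/\sim_{\mathfrak{F}}$. Let $x\in\mathbb{Q}_*$ with representative $(x_n)_{n\in\omega}$. Then there exists a big subsequence of $(x_n)$ which is strictly increasing, or strictly decreasing, or stationary (constant), and these three cases are mutually exclusive (for a given $x$, big subsequences of two different kinds cannot both exist). Moreover, if $x$ is not infinitely large, then such a subsequence is fundamental (Cauchy in the usual metric of $\mathbb{Q}$), and any two such big subsequences $(x_{n_k})$ and $(x_{m_k})$ are equivalent in the usual metric sense: $\lim_{k\to\infty}(x_{n_k}-x_{m_k})=0$.
   Context: A non-principal ultrafilter $\mathfrak{F}$ on $\omega$ is selective if for every partition $\{S_n\}_{n\in\omega}$ of $\omega$ with $S_n\notin\mathfrak{F}$ for all $n$ there exists $B\in\mathfrak{F}$ with $B\cap S_n$ a singleton for every $n$ (existence assumed via ZFC + CH). Sets in $\mathfrak{F}$ are called big. $\mathbb{Q}_*$ is the ultrapower of $\mathbb{Q}$: sequences $(x_i),(y_i)\in\mathbb{Q}^\omega$ are equivalent iff $\{i: x_i=y_i\}\in\mathfrak{F}$; it is an ordered field containing $\mathbb{Q}$ via constant sequences. A subsequence $(x_{n_k})_{k\in\omega}$ (with $n_0<n_1<\dots$) of $(x_n)$ is big if the index set $\{n_k:k\in\omega\}$ belongs to $\mathfrak{F}$. An element $x\in\mathbb{Q}_*$ is infinitely large if $|x|>|q|$ for all $q\in\mathbb{Q}$. *)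

theory Defs
  imports Complex_Main "HOL-Library.Disjoint_Sets"
begin

section \<open>Selective ultrafilters\<close>

text \<open>A family of subsets of \<open>\<omega>\<close> closed under supersets and finite intersections is
  represented by the library type \<^typ>\<open>nat filter\<close>.\<close>

definition big :: "nat filter \<Rightarrow> nat set \<Rightarrow> bool" where
  "big F A \<longleftrightarrow> eventually (\<lambda>i. i \<in> A) F"

definition nonprincipal_ultrafilter :: "nat filter \<Rightarrow> bool" where
  "nonprincipal_ultrafilter F \<longleftrightarrow>
     F \<noteq> bot \<and> (\<forall>A. big F A \<or> big F (- A)) \<and> (\<forall>A. F \<noteq> principal A)"

text \<open>The blocks of a partition are nonempty; without this clause no ultrafilter would be selective.\<close>

definition selective_ultrafilter :: "nat filter \<Rightarrow> bool" where
  "selective_ultrafilter F \<longleftrightarrow>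
     nonprincipal_ultrafilter F \<and>
     (\<forall>S :: nat \<Rightarrow> nat set.
        (\<forall>n. S n \<noteq> {}) \<and> disjoint_family S \<and> (\<Union>n. S n) = UNIV \<and> (\<forall>n. \<not> big F (S n))
        \<longrightarrow> (\<exists>B. big F B \<and> (\<forall>n. is_singleton (B \<inter> S n))))"


section \<open>The ultrapower of the rationals\<close>

text \<open>The ultrapower depends on the term \<open>F\<close>, so its elements are the equivalence classes
  themselves, sets of sequences.\<close>

definition qstar_rel :: "nat filter \<Rightarrow> ((nat \<Rightarrow> rat) \<times> (nat \<Rightarrow> rat)) set" where
  "qstar_rel F = {(x, y). big F {i. x i = y i}}"

definition qstar :: "nat filter \<Rightarrow> (nat \<Rightarrow> rat) set set" where
  "qstar F = UNIV // qstar_rel F"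

definition qstar_class :: "nat filter \<Rightarrow> (nat \<Rightarrow> rat) \<Rightarrow> (nat \<Rightarrow> rat) set" where
  "qstar_class F x = qstar_rel F `` {x}"

definition qstar_of_rat :: "nat filter \<Rightarrow> rat \<Rightarrow> (nat \<Rightarrow> rat) set" where
  "qstar_of_rat F q = qstar_class F (\<lambda>_. q)"

definition qstar_less :: "nat filter \<Rightarrow> (nat \<Rightarrow> rat) set \<Rightarrow> (nat \<Rightarrow> rat) set \<Rightarrow> bool" where
  "qstar_less F X Y \<longleftrightarrow> (\<exists>x\<in>X. \<exists>y\<in>Y. big F {i. x i < y i})"

definition qstar_uminus :: "nat filter \<Rightarrow> (nat \<Rightarrow> rat) set \<Rightarrow> (nat \<Rightarrow> rat) set" where
  "qstar_uminus F X = (\<Union>x\<in>X. qstar_class F (\<lambda>i. - x i))"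

definition qstar_abs :: "nat filter \<Rightarrow> (nat \<Rightarrow> rat) set \<Rightarrow> (nat \<Rightarrow> rat) set" where
  "qstar_abs F X = (if qstar_less F X (qstar_of_rat F 0) then qstar_uminus F X else X)"

definition infinitely_large :: "nat filter \<Rightarrow> (nat \<Rightarrow> rat) set \<Rightarrow> bool" where
  "infinitely_large F X \<longleftrightarrow> (\<forall>q. qstar_less F (qstar_of_rat F \<bar>q\<bar>) (qstar_abs F X))"

lemma equiv_qstar_rel: "equiv UNIV (qstar_rel F)"
proof (rule equivI)
  show "refl (qstar_rel F)" "sym (qstar_rel F)"
    by (auto simp: refl_on_def sym_def qstar_rel_def big_def eq_commute)
  show "trans (qstar_rel F)"
    by (auto intro!: transI simp: qstar_rel_def big_def elim: eventually_elim2)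
qed simp

lemma qstar_class_iff: "y \<in> qstar_class F x \<longleftrightarrow> big F {i. x i = y i}"
  by (simp add: qstar_class_def qstar_rel_def)

lemma qstar_class_eq_iff: "qstar_class F x = qstar_class F y \<longleftrightarrow> big F {i. x i = y i}"
  using eq_equiv_class_iff[OF equiv_qstar_rel, of x y F]
  by (simp add: qstar_class_def qstar_rel_def)

lemma qstar_less_class:
  "qstar_less F (qstar_class F x) (qstar_class F y) \<longleftrightarrow> big F {i. x i < y i}"
proof
  assume "qstar_less F (qstar_class F x) (qstar_class F y)"
  then obtain x' y' where "big F {i. x i = x' i}" "big F {i. y i = y' i}" "big F {i. x' i < y' i}"
    by (auto simp: qstar_less_def qstar_class_iff)
  then show "big F {i. x i < y i}"
    unfolding big_def by eventually_elim simp
next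
  assume "big F {i. x i < y i}"
  moreover have "x \<in> qstar_class F x" "y \<in> qstar_class F y"
    by (simp_all add: qstar_class_iff big_def)
  ultimately show "qstar_less F (qstar_class F x) (qstar_class F y)"
    unfolding qstar_less_def by blast
qed

lemma qstar_uminus_class: "qstar_uminus F (qstar_class F x) = qstar_class F (\<lambda>i. - x i)"
proof -
  have "qstar_class F (\<lambda>i. - y i) = qstar_class F (\<lambda>i. - x i)" if "y \<in> qstar_class F x" for y
    using that by (simp add: qstar_class_iff qstar_class_eq_iff big_def eq_commute)
  moreover have "x \<in> qstar_class F x"
    by (simp add: qstar_class_iff big_def)
  ultimately show ?thesis
    unfolding qstar_uminus_def by blast
qed

lemma qstar_abs_class:
  assumes "nonprincipal_ultrafilter F"
  shows "qstar_abs F (qstar_class F x) = qstar_class F (\<lambda>i. \<bar>x i\<bar>)"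
proof (cases "big F {i. x i < 0}")
  case True
  then have "big F {i. - x i = \<bar>x i\<bar>}"
    unfolding big_def by eventually_elim simp
  with True show ?thesis
    by (simp add: qstar_abs_def qstar_of_rat_def qstar_less_class qstar_uminus_class
        qstar_class_eq_iff)
next
  case False
  then have "big F (- {i. x i < 0})"
    using assms by (auto simp: nonprincipal_ultrafilter_def)
  then have "big F {i. x i = \<bar>x i\<bar>}"
    unfolding big_def by eventually_elim simp
  with False show ?thesis
    by (simp add: qstar_abs_def qstar_of_rat_def qstar_less_class qstar_class_eq_iff)
qed


section \<open>Big subsequences\<close>

text \<open>The subsequence of \<open>x\<close> along the index sequence \<open>n\<close> is \<open>x \<circ> n\<close>; whether it is big
  depends only on \<open>n\<close>.\<close>

definition big_indices :: "nat filter \<Rightarrow> (nat \<Rightarrow> nat) \<Rightarrow> bool" where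
  "big_indices F n \<longleftrightarrow> strict_mono n \<and> big F (range n)"

definition strictly_decreasing :: "(nat \<Rightarrow> rat) \<Rightarrow> bool" where
  "strictly_decreasing s \<longleftrightarrow> strict_antimono_on UNIV s"

definition stationary :: "(nat \<Rightarrow> rat) \<Rightarrow> bool" where
  "stationary s \<longleftrightarrow> (\<exists>c. \<forall>k. s k = c)"

definition inc_dec_or_stationary :: "(nat \<Rightarrow> rat) \<Rightarrow> bool" where
  "inc_dec_or_stationary s \<longleftrightarrow> strict_mono s \<or> strictly_decreasing s \<or> stationary s"

definition has_big_subseq :: "nat filter \<Rightarrow> ((nat \<Rightarrow> rat) \<Rightarrow> bool) \<Rightarrow> (nat \<Rightarrow> rat) \<Rightarrow> bool" where
  "has_big_subseq F P x \<longleftrightarrow> (\<exists>n. big_indices F n \<and> P (x \<circ> n))"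

text \<open>\<^typ>\<open>rat\<close> carries no metric in the library; its usual metric is the one inherited from
  the reals.\<close>

definition fundamental :: "(nat \<Rightarrow> rat) \<Rightarrow> bool" where
  "fundamental s \<longleftrightarrow> Cauchy (\<lambda>k. real_of_rat (s k))"

end

theory Submission
  imports Defs "HOL-Library.Infinite_Set" "HOL-Library.Countable_Set"
begin

text \<open>
  For a big set of indices \<open>i\<close> the same one of the three sets \<open>{j. x j > x i}\<close>,
  \<open>{j. x j < x i}\<close>, \<open>{j. x j = x i}\<close> is big. A selective ultrafilter admits diagonal
  intersections: given big sets \<open>U i\<close> there is a big \<open>H\<close> with \<open>j \<in> U i\<close> for all \<open>i < j\<close> in \<open>H\<close>.
  Applied to the sets above, this yields the monotone big subsequence. Since a non-principal
  ultrafilter refines the cofinite filter, a limit of a big subsequence is the limit of the whole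
  sequence along the ultrafilter, hence it does not depend on the subsequence.
\<close>

section \<open>Selective ultrafilters\<close>

lemma not_eventually_ultra:
  assumes "nonprincipal_ultrafilter F" "\<not> eventually P F"
  shows "eventually (\<lambda>i. \<not> P i) F"
proof -
  have "big F {i. P i} \<or> big F (- {i. P i})"
    using assms(1) unfolding nonprincipal_ultrafilter_def by blast
  with assms(2) show ?thesis by (simp add: big_def)
qed

lemma nonprincipal_not_singleton:
  assumes "nonprincipal_ultrafilter F"
  shows "eventually (\<lambda>i. i \<noteq> a) F"
proof (rule ccontr)
  assume "\<not> ?thesis"
  from not_eventually_ultra[OF assms this] have a: "eventually (\<lambda>i. i = a) F" by simp
  \<comment> \<open>If \<open>{a}\<close> were big, every property would be decided by its value at
    \<open>a\<close>, which makes \<open>F\<close> principal.\<close>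
  have "eventually P F \<longleftrightarrow> P a" for P
  proof
    assume "eventually P F"
    with a have "eventually (\<lambda>i. P a) F" by eventually_elim simp
    then show "P a"
      using assms by (auto simp: nonprincipal_ultrafilter_def)
  next
    assume "P a"
    with a show "eventually P F" by (auto elim: eventually_mono)
  qed
  then have "F = principal {a}"
    by (simp add: filter_eq_iff eventually_principal)
  then show False
    using assms by (auto simp: nonprincipal_ultrafilter_def)
qed

lemma nonprincipal_le_sequentially:
  assumes "nonprincipal_ultrafilter F"
  shows "F \<le> sequentially"
proof (rule filter_leI)
  fix P :: "nat \<Rightarrow> bool"
  assume "eventually P sequentially"
  then have "finite {i. \<not> P i}"
    by (simp flip: cofinite_eq_sequentially add: eventually_cofinite)
  then have "eventually (\<lambda>i. \<forall>a\<in>{i. \<not> P i}. i \<noteq> a) F"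
    using nonprincipal_not_singleton[OF assms] by (intro eventually_ball_finite) auto
  then show "eventually P F" by (rule eventually_mono) blast
qed

text \<open>Big sets are unbounded. Two ordered points are what it takes to tell increasing,
  decreasing and constant apart.\<close>

lemma eventually_ultra_two:
  assumes "nonprincipal_ultrafilter F" "eventually P F"
  obtains i j :: nat where "i < j" "P i" "P j"
proof -
  have ne: "F \<noteq> bot"
    using assms(1) by (simp add: nonprincipal_ultrafilter_def)
  obtain i where i: "P i"
    using eventually_happens'[OF ne assms(2)] by blast
  have "eventually (\<lambda>j. i < j) F"
    using nonprincipal_le_sequentially[OF assms(1)] eventually_gt_at_top by (rule filter_leD)
  with assms(2) have "eventually (\<lambda>j. P j \<and> i < j) F" by (rule eventually_conj)
  from eventually_happens'[OF ne this] i show thesis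
    using that by blast
qed

lemma big_infinite:
  assumes "nonprincipal_ultrafilter F" "big F A"
  shows "infinite A"
proof
  assume "finite A"
  then have "eventually (\<lambda>i. \<forall>a\<in>A. i \<noteq> a) F"
    using nonprincipal_not_singleton[OF assms(1)] by (intro eventually_ball_finite) auto
  with assms(2) have "eventually (\<lambda>i. False) F"
    unfolding big_def by eventually_elim blast
  then show False
    using assms(1) by (simp add: nonprincipal_ultrafilter_def)
qed

section \<open>Selectors and diagonal intersections\<close>

text \<open>Selectivity for functions instead of partitions: a set meeting every fibre of
  \<open>f\<close> in one point is a set on which \<open>f\<close> is injective.\<close>

lemma selective_inj_on:
  fixes f :: "nat \<Rightarrow> 'a"
  assumes sel: "selective_ultrafilter F"
    and fibres: "\<And>c. \<not> big F {i. f i = c}"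
  obtains B where "big F B" "inj_on f B"
proof -
  have np: "nonprincipal_ultrafilter F"
    using sel by (simp add: selective_ultrafilter_def)
  \<comment> \<open>Selectivity needs infinitely many nonempty blocks. Finitely many non-big fibres
    could not cover the index set, since their complements would have a big, yet empty,
    intersection.\<close>
  have "infinite (range f)"
  proof
    assume "finite (range f)"
    moreover have "\<forall>c\<in>range f. eventually (\<lambda>i. f i \<noteq> c) F"
      using not_eventually_ultra[OF np] fibres by (auto simp: big_def)
    ultimately have "eventually (\<lambda>i. \<forall>c\<in>range f. f i \<noteq> c) F"
      by (rule eventually_ball_finite)
    then have "eventually (\<lambda>i. False) F" by (rule eventually_mono) blast
    then show False
      using np by (simp add: nonprincipal_ultrafilter_def)
  qed
  then have bij: "bij_betw (from_nat_into (range f)) UNIV (range f)"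
    by (intro bij_betw_from_nat_into) auto
  define e where "e = from_nat_into (range f)"
  have e_inj: "inj e" and e_range: "range e = range f"
    using bij by (simp_all add: e_def bij_betw_def)
  define S where "S n = {i. f i = e n}" for n
  have "S n \<noteq> {}" for n
    using e_range by (auto simp: S_def) (metis rangeE rangeI)
  moreover have "disjoint_family S"
    using e_inj by (auto simp: S_def disjoint_family_on_def inj_def)
  moreover have "(\<Union>n. S n) = UNIV"
    using e_range by (auto simp: S_def)
  moreover have "\<not> big F (S n)" for n
    using fibres by (simp add: S_def)
  ultimately have "\<exists>B. big F B \<and> (\<forall>n. is_singleton (B \<inter> S n))"
    using sel unfolding selective_ultrafilter_def by simp
  then obtain B where B: "big F B" "\<And>n. is_singleton (B \<inter> S n)"
    by blast
  have "inj_on f B"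
  proof (rule inj_onI)
    fix i j assume ij: "i \<in> B" "j \<in> B" "f i = f j"
    obtain n where "f i = e n"
      using e_range by (metis rangeE rangeI)
    with ij have "i \<in> B \<inter> S n" "j \<in> B \<inter> S n"
      by (auto simp: S_def)
    with B(2)[of n] show "i = j"
      by (metis is_singletonE singletonD)
  qed
  with B(1) show thesis by (rule that)
qed

text \<open>The P-point property. Let \<open>f k\<close> be the first stage at which
  \<open>k\<close> leaves the family. Where \<open>f\<close> is injective, only finitely many
  \<open>k\<close> have left by stage \<open>i\<close>.\<close>

lemma selective_pseudo_intersection:
  fixes U :: "nat \<Rightarrow> nat set"
  assumes sel: "selective_ultrafilter F"
    and U: "\<And>i. big F (U i)"
  obtains B where "big F B" "\<And>i. finite (B - U i)"
proof -
  have np: "nonprincipal_ultrafilter F"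
    using sel by (simp add: selective_ultrafilter_def)
  \<comment> \<open>The alternative \<open>k < n\<close> supplies a value when \<open>k\<close> lies
    in every \<open>U n\<close>. Fibres stay non-big: on \<open>f k = c\<close> either
    \<open>k\<close> misses the big set \<open>U c\<close> or \<open>k < c\<close>.\<close>
  define f where "f k = (LEAST n. k \<notin> U n \<or> k < n)" for k
  have f: "k \<notin> U (f k) \<or> k < f k" for k
    unfolding f_def by (rule LeastI[of _ "Suc k"]) simp
  have "\<not> big F {k. f k = c}" for c
  proof
    assume "big F {k. f k = c}"
    moreover have "eventually (\<lambda>k. c \<le> k) F"
      using nonprincipal_le_sequentially[OF np] eventually_ge_at_top by (rule filter_leD)
    ultimately have "eventually (\<lambda>k. False) F"
      using U[of c] unfolding big_def
    proof eventually_elim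
      case (elim k)
      then show ?case using f[of k] by simp
    qed
    then show False
      using np by (simp add: nonprincipal_ultrafilter_def)
  qed
  then obtain B where B: "big F B" "inj_on f B"
    by (rule selective_inj_on[OF sel, of f])
  have "finite (B - U i)" for i
  proof (rule finite_subset)
    show "B - U i \<subseteq> f -` {..i} \<inter> B"
      by (auto simp: f_def intro: Least_le)
    show "finite (f -` {..i} \<inter> B)"
      using B(2) by (intro finite_vimage_IntI) auto
  qed
  with B(1) show thesis by (rule that)
qed

text \<open>A pseudo-intersection \<open>B\<close> gives thresholds \<open>g m\<close> past which
  its points lie in every \<open>U i\<close> with \<open>i < m\<close>. Iterating \<open>g\<close>
  cuts the indices into finite blocks, and a selector \<open>C\<close> takes at most one point from
  each.\<close>

lemma selective_diagonal:
  fixes U :: "nat \<Rightarrow> nat set"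
  assumes sel: "selective_ultrafilter F"
    and U: "\<And>i. big F (U i)"
  obtains H where "big F H" "\<And>i j. i \<in> H \<Longrightarrow> j \<in> H \<Longrightarrow> i < j \<Longrightarrow> j \<in> U i"
proof -
  have np: "nonprincipal_ultrafilter F"
    using sel by (simp add: selective_ultrafilter_def)
  obtain B where B: "big F B" "\<And>i. finite (B - U i)"
    using selective_pseudo_intersection[OF sel, of U] U by metis
  have "\<exists>b>m. \<forall>i<m. \<forall>j\<in>B. b \<le> j \<longrightarrow> j \<in> U i" for m :: nat
  proof -
    have "finite (\<Union>i<m. B - U i)"
      using B(2) by (intro finite_UN_I) simp_all
    then obtain b where b: "\<forall>j\<in>(\<Union>i<m. B - U i). j < b"
      using finite_nat_set_iff_bounded by blast
    show ?thesis
    proof (intro exI conjI allI impI ballI)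
      show "m < max b (Suc m)" by simp
      fix i j assume ij: "i < m" "j \<in> B" "max b (Suc m) \<le> j"
      then have "j \<notin> (\<Union>i<m. B - U i)"
        using b by (metis max.bounded_iff not_le)
      with ij show "j \<in> U i" by blast
    qed
  qed
  then obtain g where g: "\<And>m. m < g m"
    and gU: "\<And>m i j. i < m \<Longrightarrow> j \<in> B \<Longrightarrow> g m \<le> j \<Longrightarrow> j \<in> U i"
    by metis
  \<comment> \<open>The values \<open>a n\<close> are the block boundaries. Below,
    \<open>f k\<close> numbers the block of \<open>k\<close>, counted from 1 because
    \<open>a 0 = 0\<close>.\<close>
  define a where "a n = (g ^^ n) 0" for n
  have a_Suc: "a (Suc n) = g (a n)" for n by (simp add: a_def)
  have "strict_mono a"
    by (simp add: strict_mono_Suc_iff a_Suc g)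
  then have a_ge: "n \<le> a n" for n by (rule strict_mono_imp_increasing)
  define f where "f k = (LEAST n. k < a n)" for k
  have f: "k < a (f k)" for k
    unfolding f_def by (rule LeastI[of _ "Suc k"]) (use a_ge[of "Suc k"] in simp)
  have f_le: "f k \<le> n" if "k < a n" for k n
    unfolding f_def using that by (rule Least_le)
  have "\<not> big F {k. f k = c}" for c
  proof
    assume "big F {k. f k = c}"
    then have "infinite {k. f k = c}" by (rule big_infinite[OF np])
    moreover have "{k. f k = c} \<subseteq> {..<a c}"
      using f by auto
    ultimately show False
      using finite_subset by blast
  qed
  then obtain C where C: "big F C" "inj_on f C"
    by (rule selective_inj_on[OF sel, of f])
  txt \<open>Keeping only blocks of one parity leaves a whole block between any two chosen points.\<close>
  have "\<exists>p. eventually (\<lambda>k. even (f k) = p) F"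
    using not_eventually_ultra[OF np, of "\<lambda>k. even (f k)"]
    by (cases "eventually (\<lambda>k. even (f k)) F") (auto intro: exI[of _ True] exI[of _ False])
  then obtain p where p: "eventually (\<lambda>k. even (f k) = p) F" by blast
  define H where "H = {k \<in> B \<inter> C. even (f k) = p}"
  have "big F H"
    using B(1) C(1) p unfolding H_def big_def by eventually_elim auto
  moreover have "j \<in> U i" if "i \<in> H" "j \<in> H" "i < j" for i j
  proof -
    have "f i \<le> f j"
      using f[of j] that(3) by (intro f_le) simp
    moreover have "f i \<noteq> f j"
      using that C(2) by (auto simp: H_def inj_on_def)
    moreover have "even (f i) = even (f j)"
      using that by (simp add: H_def)
    ultimately have "Suc (f i) < f j"
      by (metis even_Suc le_neq_implies_less Suc_lessI)
    \<comment> \<open>Otherwise minimality would give \<open>f j \<le> Suc (f i)\<close>. As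
      \<open>i < a (f i)\<close> and \<open>a (Suc (f i)) = g (a (f i))\<close>, \<open>gU\<close>
      then applies with \<open>m = a (f i)\<close>.\<close>
    then have "a (Suc (f i)) \<le> j"
      using f_le[of j "Suc (f i)"] by (metis not_le)
    with that show ?thesis
      by (intro gU[OF f[of i]]) (auto simp: a_Suc H_def)
  qed
  ultimately show thesis by (rule that)
qed

section \<open>Big subsequences\<close>

lemma has_big_subseqI:
  assumes "nonprincipal_ultrafilter F" "big F H"
    and "\<And>n. strict_mono n \<Longrightarrow> range n = H \<Longrightarrow> P (x \<circ> n)"
  shows "has_big_subseq F P x"
proof -
  have "infinite H" using assms(1,2) by (rule big_infinite)
  then have "strict_mono (enumerate H)" "range (enumerate H) = H"
    by (simp_all add: strict_mono_enumerate range_enumerate)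
  with assms(2,3) show ?thesis
    unfolding has_big_subseq_def big_indices_def by metis
qed

text \<open>A Ramsey-type step: diagonalising the sets \<open>{j. R (x i) (x j)}\<close> turns a
  relation that holds for most \<open>j\<close>, for most \<open>i\<close>, into one that holds for
  all ordered pairs of terms.\<close>

lemma selective_pairwise_subseq:
  fixes x :: "nat \<Rightarrow> rat"
  assumes sel: "selective_ultrafilter F"
    and R: "eventually (\<lambda>i. eventually (\<lambda>j. R (x i) (x j)) F) F"
  shows "has_big_subseq F (\<lambda>s. \<forall>k l. k < l \<longrightarrow> R (s k) (s l)) x"
proof -
  have np: "nonprincipal_ultrafilter F"
    using sel by (simp add: selective_ultrafilter_def)
  define C where "C = {i. eventually (\<lambda>j. R (x i) (x j)) F}"
  \<comment> \<open>The default \<open>UNIV\<close> makes every \<open>U i\<close> big; intersecting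
    \<open>H\<close> with \<open>C\<close> later discards the indices where it was used.\<close>
  define U where "U i = (if i \<in> C then {j. R (x i) (x j)} else UNIV)" for i
  have "big F (U i)" for i
    by (simp add: U_def C_def big_def)
  then obtain H where H: "big F H" "\<And>i j. i \<in> H \<Longrightarrow> j \<in> H \<Longrightarrow> i < j \<Longrightarrow> j \<in> U i"
    using selective_diagonal[OF sel] by metis
  have "big F (H \<inter> C)"
    using H(1) R unfolding big_def C_def by eventually_elim simp
  then show ?thesis
  proof (rule has_big_subseqI[OF np], intro allI impI)
    fix n :: "nat \<Rightarrow> nat" and k l :: nat
    assume n: "strict_mono n" "range n = H \<inter> C" and "k < l"
    then have "n k < n l" "n k \<in> H \<inter> C" "n l \<in> H \<inter> C"
      by (auto simp: strict_mono_less)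
    then show "R ((x \<circ> n) k) ((x \<circ> n) l)"
      using H(2)[of "n k" "n l"] by (simp add: U_def)
  qed
qed

lemma has_big_subseq_mono:
  assumes "has_big_subseq F P x" "\<And>s. P s \<Longrightarrow> Q s"
  shows "has_big_subseq F Q x"
  using assms unfolding has_big_subseq_def by blast

lemma selective_has_big_subseq:
  assumes sel: "selective_ultrafilter F"
  shows "has_big_subseq F inc_dec_or_stationary x"
proof -
  have np: "nonprincipal_ultrafilter F"
    using sel by (simp add: selective_ultrafilter_def)
  define ev where "ev R = eventually (\<lambda>i. eventually (\<lambda>j. R (x i) (x j)) F) F" for R
  have tri: "eventually (\<lambda>j. x i < x j) F \<or> eventually (\<lambda>j. x i > x j) F \<or> eventually (\<lambda>j. x i = x j) F"
    for i
  proof (rule ccontr)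
    assume "\<not> ?thesis"
    then have "eventually (\<lambda>j. \<not> x i < x j) F" "eventually (\<lambda>j. \<not> x i > x j) F"
      "eventually (\<lambda>j. \<not> x i = x j) F"
      by (auto intro: not_eventually_ultra[OF np])
    then have "eventually (\<lambda>j. False) F" by eventually_elim auto
    then show False
      using np by (simp add: nonprincipal_ultrafilter_def)
  qed
  \<comment> \<open>The ultrafilter decides twice: first, for each \<open>i\<close>, which relation
    to \<open>x i\<close> prevails, then which of the three answers occurs for a big set of
    \<open>i\<close>.\<close>
  have "ev (<) \<or> ev (>) \<or> ev (=)"
  proof (rule ccontr)
    assume "\<not> ?thesis"
    then have "eventually (\<lambda>i. \<not> eventually (\<lambda>j. x i < x j) F) F"
      "eventually (\<lambda>i. \<not> eventually (\<lambda>j. x i > x j) F) F"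
      "eventually (\<lambda>i. \<not> eventually (\<lambda>j. x i = x j) F) F"
      unfolding ev_def by (auto intro: not_eventually_ultra[OF np])
    then have "eventually (\<lambda>i. False) F" by eventually_elim (use tri in blast)
    then show False
      using np by (simp add: nonprincipal_ultrafilter_def)
  qed
  then show ?thesis
  proof (elim disjE)
    assume "ev (<)"
    then show ?thesis
      unfolding ev_def
      by (rule has_big_subseq_mono[OF selective_pairwise_subseq[OF sel]])
        (simp add: inc_dec_or_stationary_def strict_mono_def)
  next
    assume "ev (>)"
    then show ?thesis
      unfolding ev_def
      by (rule has_big_subseq_mono[OF selective_pairwise_subseq[OF sel]])
        (simp add: inc_dec_or_stationary_def strictly_decreasing_def monotone_on_def)
  next
    assume "ev (=)"
    then have "has_big_subseq F (\<lambda>s. \<forall>k l. k < l \<longrightarrow> s k = s l) x"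
      unfolding ev_def by (rule selective_pairwise_subseq[OF sel])
    moreover have "inc_dec_or_stationary s" if "\<forall>k l. k < l \<longrightarrow> s k = s l" for s :: "nat \<Rightarrow> rat"
    proof -
      have "s k = s 0" for k using that by (cases k) (auto, metis zero_less_Suc)
      then show ?thesis by (auto simp: inc_dec_or_stationary_def stationary_def)
    qed
    ultimately show ?thesis by (rule has_big_subseq_mono)
  qed
qed

section \<open>Mutual exclusion of the three kinds\<close>

text \<open>Both index ranges and the agreement set of \<open>y\<close> and \<open>z\<close> are
  big, so they share two indices. The two subsequences show the same two values there in the same
  order, possibly at different positions.\<close>

lemma big_subseqs_common_indices:
  assumes np: "nonprincipal_ultrafilter F"
    and yz: "eventually (\<lambda>i. y i = z i) F"
    and "has_big_subseq F P y" "has_big_subseq F Q z"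
  obtains s t k l k' l' where "P s" "Q t" "k < l" "k' < l'" "s k = t k'" "s l = t l'"
proof -
  from assms(3) obtain n where n: "strict_mono n" "big F (range n)" "P (y \<circ> n)"
    by (auto simp: has_big_subseq_def big_indices_def)
  from assms(4) obtain m where m: "strict_mono m" "big F (range m)" "Q (z \<circ> m)"
    by (auto simp: has_big_subseq_def big_indices_def)
  have "eventually (\<lambda>i. i \<in> range n \<and> i \<in> range m \<and> y i = z i) F"
    using n(2) m(2) yz unfolding big_def by eventually_elim simp
  with np obtain i j where "i < j" and i: "i \<in> range n" "i \<in> range m" "y i = z i"
    and j: "j \<in> range n" "j \<in> range m" "y j = z j"
    by (rule eventually_ultra_two) blast
  then obtain k l k' l' where idx: "i = n k" "j = n l" "i = m k'" "j = m l'"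
    by blast
  show thesis
  proof (rule that)
    show "P (y \<circ> n)" "Q (z \<circ> m)" by (fact n m)+
    show "k < l" "k' < l'"
      using \<open>i < j\<close> idx n(1) m(1) by (metis strict_mono_less)+
    show "(y \<circ> n) k = (z \<circ> m) k'" "(y \<circ> n) l = (z \<circ> m) l'"
      using i(3) j(3) idx by (metis comp_apply)+
  qed
qed

section \<open>Limits along big subsequences\<close>

text \<open>Indices in \<open>range n\<close> that are at least \<open>n K\<close> are exactly the
  \<open>n k\<close> with \<open>k \<ge> K\<close>, and they form a big set.\<close>

lemma eventually_big_indices:
  assumes np: "nonprincipal_ultrafilter F" and n: "big_indices F n"
    and P: "eventually (\<lambda>k. P (n k)) sequentially"
  shows "eventually P F"
proof -
  have mono: "strict_mono n" and big: "big F (range n)"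
    using n by (simp_all add: big_indices_def)
  obtain K where K: "\<And>k. k \<ge> K \<Longrightarrow> P (n k)"
    using P by (auto simp: eventually_sequentially)
  have "eventually (\<lambda>i. n K \<le> i) F"
    using nonprincipal_le_sequentially[OF np] eventually_ge_at_top by (rule filter_leD)
  with big show ?thesis
    unfolding big_def
    by eventually_elim (use K mono in \<open>auto simp: strict_mono_less_eq\<close>)
qed

text \<open>The bound, given only along \<open>F\<close>, reaches every term of the subsequence: one
  term above \<open>q\<close> would put all later ones above \<open>q\<close>, hence most of
  \<open>x\<close>. Monotone convergence in the reals then applies.\<close>

lemma convergent_strict_mono_big_subseq:
  assumes np: "nonprincipal_ultrafilter F" and n: "big_indices F n"
    and mono: "strict_mono (x \<circ> n)"
    and bound: "eventually (\<lambda>i. x i \<le> q) F"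
  shows "convergent (\<lambda>k. real_of_rat (x (n k)))"
proof -
  have le: "x (n k) \<le> x (n l)" if "k \<le> l" for k l
    using mono that by (metis comp_apply strict_mono_less_eq)
  have upper: "x (n k) \<le> q" for k
  proof (rule ccontr)
    assume "\<not> x (n k) \<le> q"
    then have "eventually (\<lambda>l. q < x (n l)) sequentially"
      unfolding eventually_sequentially by (metis le less_le_trans not_le)
    then have "eventually (\<lambda>i. q < x i) F"
      by (rule eventually_big_indices[OF np n])
    with bound have "eventually (\<lambda>i. False) F" by eventually_elim simp
    then show False
      using np by (simp add: nonprincipal_ultrafilter_def)
  qed
  have "incseq (\<lambda>k. real_of_rat (x (n k)))"
    by (simp add: incseq_def of_rat_less_eq le)
  moreover have "real_of_rat (x (n k)) \<le> real_of_rat q" for k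
    by (simp add: of_rat_less_eq upper)
  ultimately show ?thesis
    by (metis incseq_convergent convergent_def)
qed

lemma convergent_big_subseq:
  assumes np: "nonprincipal_ultrafilter F" and n: "big_indices F n"
    and kind: "inc_dec_or_stationary (x \<circ> n)"
    and bound: "eventually (\<lambda>i. \<bar>x i\<bar> \<le> q) F"
  shows "convergent (\<lambda>k. real_of_rat (x (n k)))"
  using kind unfolding inc_dec_or_stationary_def
proof (elim disjE)
  assume "strict_mono (x \<circ> n)"
  moreover have "eventually (\<lambda>i. x i \<le> q) F"
    using bound by eventually_elim simp
  ultimately show ?thesis
    by (rule convergent_strict_mono_big_subseq[OF np n])
next
  assume "strictly_decreasing (x \<circ> n)"
  \<comment> \<open>Negation reduces the decreasing case to the increasing one; this is why the
    bound is on \<open>\<bar>x i\<bar>\<close>.\<close>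
  then have "strict_mono ((\<lambda>i. - x i) \<circ> n)"
    by (simp add: strictly_decreasing_def monotone_on_def)
  moreover have "eventually (\<lambda>i. - x i \<le> q) F"
    using bound by eventually_elim simp
  ultimately have "convergent (\<lambda>k. real_of_rat (- x (n k)))"
    by (rule convergent_strict_mono_big_subseq[OF np n])
  then show ?thesis
    by (simp add: of_rat_minus flip: convergent_minus_iff)
next
  assume "stationary (x \<circ> n)"
  then show ?thesis
    by (auto simp: stationary_def convergent_const)
qed

lemma tendsto_big_indices:
  assumes "nonprincipal_ultrafilter F" "big_indices F n"
    and "(\<lambda>k. y (n k)) \<longlonglongrightarrow> L"
  shows "(y \<longlongrightarrow> L) F"
  using assms(3) eventually_big_indices[OF assms(1,2)]
  by (simp add: tendsto_def)

section \<open>The claims for a fixed element of the ultrapower\<close>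

theorem theorem2:
  fixes F :: "nat filter" and X :: "(nat \<Rightarrow> rat) set" and x :: "nat \<Rightarrow> rat"
  assumes "selective_ultrafilter F"
    and "X \<in> qstar F"
    and "x \<in> X"
  shows "has_big_subseq F inc_dec_or_stationary x \<and>
         (\<forall>y\<in>X. \<forall>z\<in>X.
           \<not> (has_big_subseq F strict_mono y \<and> has_big_subseq F strictly_decreasing z) \<and>
           \<not> (has_big_subseq F strict_mono y \<and> has_big_subseq F stationary z) \<and>
           \<not> (has_big_subseq F strictly_decreasing y \<and> has_big_subseq F stationary z)) \<and>
         (\<not> infinitely_large F X \<longrightarrow>
           (\<forall>n. big_indices F n \<and> inc_dec_or_stationary (x \<circ> n) \<longrightarrow> fundamental (x \<circ> n)) \<and>
           (\<forall>n m. big_indices F n \<and> inc_dec_or_stationary (x \<circ> n) \<and>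
                  big_indices F m \<and> inc_dec_or_stationary (x \<circ> m) \<longrightarrow>
              (\<lambda>k. real_of_rat (x (n k) - x (m k))) \<longlonglongrightarrow> 0))"
proof (intro conjI ballI impI)
  have np: "nonprincipal_ultrafilter F"
    using assms(1) by (simp add: selective_ultrafilter_def)
  obtain w where "X = qstar_class F w"
    using assms(2) by (auto simp: qstar_def qstar_class_def elim: quotientE)
  with assms(3) have X: "X = qstar_class F x"
    by (simp add: qstar_class_iff qstar_class_eq_iff)
  show "has_big_subseq F inc_dec_or_stationary x"
    using assms(1) by (rule selective_has_big_subseq)
  {
    fix y z assume "y \<in> X" "z \<in> X"
    then have "eventually (\<lambda>i. x i = y i) F" "eventually (\<lambda>i. x i = z i) F"
      by (simp_all add: X qstar_class_iff big_def)
    \<comment> \<open>Exclusion is shown across any two representatives, so the kind depends on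
      \<open>X\<close> alone. At two common indices the kinds would demand incompatible order
      relations.\<close>
    then have yz: "eventually (\<lambda>i. y i = z i) F"
      by eventually_elim simp
    note common = big_subseqs_common_indices[OF np yz]
    show "\<not> (has_big_subseq F strict_mono y \<and> has_big_subseq F strictly_decreasing z)"
      by (auto elim!: common simp: strictly_decreasing_def strict_mono_def monotone_on_def)
        (metis less_asym)
    show "\<not> (has_big_subseq F strict_mono y \<and> has_big_subseq F stationary z)"
      by (auto elim!: common simp: stationary_def strict_mono_def) (metis less_irrefl)
    show "\<not> (has_big_subseq F strictly_decreasing y \<and> has_big_subseq F stationary z)"
      by (auto elim!: common simp: stationary_def strictly_decreasing_def monotone_on_def)
        (metis less_irrefl)
  }
  assume "\<not> infinitely_large F X"
  then obtain q where "\<not> big F {i. \<bar>q\<bar> < \<bar>x i\<bar>}"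
    by (auto simp: infinitely_large_def X qstar_abs_class[OF np] qstar_of_rat_def qstar_less_class)
  \<comment> \<open>The ultrafilter turns failure of infinite largeness at \<open>q\<close> into a
    bound on a big set of terms.\<close>
  then have "eventually (\<lambda>i. \<bar>x i\<bar> \<le> \<bar>q\<bar>) F"
    using not_eventually_ultra[OF np, of "\<lambda>i. \<bar>q\<bar> < \<bar>x i\<bar>"] by (simp add: big_def not_less)
  then have conv: "convergent (\<lambda>k. real_of_rat (x (n k)))"
    if "big_indices F n \<and> inc_dec_or_stationary (x \<circ> n)" for n
    using that convergent_big_subseq[OF np] by blast
  show "\<forall>n. big_indices F n \<and> inc_dec_or_stationary (x \<circ> n) \<longrightarrow> fundamental (x \<circ> n)"
    using convergent_Cauchy[OF conv] by (simp add: fundamental_def)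
  show "\<forall>n m. big_indices F n \<and> inc_dec_or_stationary (x \<circ> n) \<and>
          big_indices F m \<and> inc_dec_or_stationary (x \<circ> m) \<longrightarrow>
          (\<lambda>k. real_of_rat (x (n k) - x (m k))) \<longlonglongrightarrow> 0"
  proof (intro allI impI)
    fix n m
    assume A: "big_indices F n \<and> inc_dec_or_stationary (x \<circ> n) \<and>
      big_indices F m \<and> inc_dec_or_stationary (x \<circ> m)"
    obtain L where L: "(\<lambda>k. real_of_rat (x (n k))) \<longlonglongrightarrow> L"
      using conv[of n] A by (auto simp: convergent_def)
    obtain M where M: "(\<lambda>k. real_of_rat (x (m k))) \<longlonglongrightarrow> M"
      using conv[of m] A by (auto simp: convergent_def)
    \<comment> \<open>Both limits become limits of the one sequence \<open>x\<close> along the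
      proper filter \<open>F\<close>, where limits in the reals are unique.\<close>
    have "((\<lambda>i. real_of_rat (x i)) \<longlongrightarrow> L) F" "((\<lambda>i. real_of_rat (x i)) \<longlongrightarrow> M) F"
      using A L M by (auto intro: tendsto_big_indices[OF np])
    then have "L = M"
      using np by (intro tendsto_unique) (auto simp: nonprincipal_ultrafilter_def)
    then show "(\<lambda>k. real_of_rat (x (n k) - x (m k))) \<longlonglongrightarrow> 0"
      using tendsto_diff[OF L M] by (simp add: of_rat_diff)
  qed
qed

end
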